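(* Let $k$ be a positive integer and let $G$ be a $k$-connected graph on $n$ vertices. If $P$ and $Q$ are any two longest paths in $G$, then \[ |V(P)\cap V(Q)| \ge \min\left\{ k, \left\lceil \frac{8k-n-4}{3}\right\rceil\right\}. \]
   Context: All graphs are finite and simple. A graph is $k$-connected if it has more than $k$ vertices and remains connected after deleting any set of fewer than $k$ vertices. The length of a path is its number of edges, and a longest path in $G$ is a path of maximum length among all paths in $G$. $V(P)$ denotes the vertex set of $P$. *)

theory Defs
  imports Complex_Main "Graph_Theory.Graph_Theory"
begin

text \<open>
  A finite simple graph is a \<^locale>\<open>graph\<close>: a finite, loop-free digraph without parallel arcs whose
  arc relation is symmetric, so that an undirected edge is a pair of opposite arcs. A path is a
  \<^const>\<open>vpath\<close>, given by its nonempty list of distinct vertices; its vertex set is \<open>set P\<close> and its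
  length \<open>vwalk_length P\<close> is its number of edges. One undirected path has two such lists, one for
  each direction; vertex set and length agree on both.
\<close>

text \<open>
  The qualified name avoids the topological constant \<open>connected\<close>.
\<close>

definition k_connected :: "nat \<Rightarrow> ('a, 'b) pre_digraph \<Rightarrow> bool" where
  "k_connected k G \<longleftrightarrow> card (verts G) > k \<and>
     (\<forall>S. S \<subseteq> verts G \<and> card S < k \<longrightarrow>
        Digraph_Component.connected (G \<restriction> (verts G - S)))"

definition longest_path :: "'a vwalk \<Rightarrow> ('a, 'b) pre_digraph \<Rightarrow> bool" where
  "longest_path P G \<longleftrightarrow> vpath P G \<and> (\<forall>R. vpath R G \<longrightarrow> vwalk_length R \<le> vwalk_length P)"

end

theory Submission
  imports Defs
begin

text \<open>
  Suppose that the longest paths \<open>P\<close> and \<open>Q\<close>, with \<open>p\<close> vertices each, share \<open>s < k\<close> vertices. If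
  some vertex lies outside \<open>P\<close>, Dirac's argument at the two ends of \<open>P\<close> gives \<open>p \<ge> 2k + 1\<close>. As
  \<open>2k + 1 > 2s + 1\<close>, two consecutive vertices of \<open>Q\<close> avoid \<open>P\<close>, so \<open>G - P\<close> has a component with at
  least two vertices. The successors on \<open>P\<close> of its neighbours then form a third set of about \<open>k\<close>
  positions, disjoint from the two in Dirac's argument, and \<open>p \<ge> 3k > 3s + 2\<close>. Hence three
  consecutive vertices of \<open>Q\<close> avoid \<open>P\<close>, and for their component the second successors give a fourth
  such set, so \<open>p \<ge> 4k - 2\<close>. Since \<open>2p - s \<le> n\<close>, this yields \<open>s \<ge> 8k - 4 - n\<close>.
\<close>

section \<open>Lists in which every long window meets a set\<close>

lemma vwalk_arcs_subset_iff_successively: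
  "set (vwalk_arcs p) \<subseteq> R \<longleftrightarrow> successively (\<lambda>x y. (x, y) \<in> R) p"
  by (induction p rule: vwalk_arcs.induct) auto

text \<open>Induction strips the list up to its first entry in \<open>S\<close>. At most
  \<open>t\<close> entries precede that one, so each entry of \<open>S\<close> pays for
  \<open>Suc t\<close> positions; the final \<open>t\<close> covers the tail after the last of
  them.\<close>

lemma length_le_if_no_window_avoids:
  assumes "\<And>as zs bs. xs = as @ zs @ bs \<Longrightarrow> length zs = Suc t \<Longrightarrow> set zs \<inter> S \<noteq> {}"
    and "distinct xs"
  shows "length xs \<le> Suc t * card (S \<inter> set xs) + t"
  using assms
proof (induction xs rule: length_induct)
  case (1 xs)
  let ?p = "takeWhile (\<lambda>x. x \<notin> S) xs" and ?r = "dropWhile (\<lambda>x. x \<notin> S) xs"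
  have p: "length ?p \<le> t"
  proof (rule ccontr)
    assume long: "\<not> length ?p \<le> t"
    have "set (take (Suc t) ?p) \<inter> S = {}"
      by (auto dest!: in_set_takeD set_takeWhileD)
    moreover have "xs = [] @ take (Suc t) ?p @ (drop (Suc t) ?p @ ?r)"
      by (metis append.assoc append_Nil append_take_drop_id takeWhile_dropWhile_id)
    ultimately show False
      using 1(2)[of "[]" "take (Suc t) ?p" "drop (Suc t) ?p @ ?r"] long by simp
  qed
  show ?case
  proof (cases ?r)
    case Nil
    then have "xs = ?p"
      by (metis append_Nil2 takeWhile_dropWhile_id)
    then show ?thesis using p by simp
  next
    case (Cons y zs)
    have xs: "xs = ?p @ y # zs" using Cons by (metis takeWhile_dropWhile_id)
    have y: "y \<in> S" using Cons by (metis (mono_tags) dropWhile_eq_Cons_conv)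
    have len: "length xs = length ?p + Suc (length zs)" by (subst xs) simp
    have dis: "distinct (?p @ y # zs)" using 1(3) xs by simp
    have win: "set ws \<inter> S \<noteq> {}" if "zs = as @ ws @ bs" "length ws = Suc t" for as ws bs
      using 1(2)[of "?p @ y # as" ws bs] that xs by simp
    have IH: "length zs \<le> Suc t * card (S \<inter> set zs) + t"
      using 1(1)[rule_format, of zs] len win dis by simp
    have "insert y (S \<inter> set zs) \<subseteq> S \<inter> set xs" using y arg_cong[OF xs, of set] by auto
    then have "card (insert y (S \<inter> set zs)) \<le> card (S \<inter> set xs)" by (intro card_mono) auto
    then have "Suc (card (S \<inter> set zs)) \<le> card (S \<inter> set xs)" using dis by simp
    then have "Suc t * Suc (card (S \<inter> set zs)) \<le> Suc t * card (S \<inter> set xs)" by (rule mult_le_mono2)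
    then show ?thesis using p IH len by simp
  qed
qed

section \<open>Simple graphs, paths and components\<close>

locale simple_graph =
  fixes V :: "'a set" and E :: "'a \<Rightarrow> 'a \<Rightarrow> bool"
  assumes fin: "finite V"
    and E_V: "E x y \<Longrightarrow> x \<in> V \<and> y \<in> V"
    and E_sym: "E x y \<Longrightarrow> E y x"
    and E_irrefl: "\<not> E x x"
begin

definition is_path :: "'a list \<Rightarrow> bool" where
  "is_path p \<longleftrightarrow> p \<noteq> [] \<and> distinct p \<and> set p \<subseteq> V \<and> successively E p"

definition nbh :: "'a set \<Rightarrow> 'a set" where
  "nbh W = {y \<in> V - W. \<exists>w\<in>W. E w y}"

lemma E_commute: "E x y \<longleftrightarrow> E y x"
  using E_sym by blast

text \<open>By symmetry of \<open>E\<close>, reversal needs no flipped relation; in the simp set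
  this rule replaces the general \<open>successively_rev\<close>.\<close>

lemma successively_rev_E [simp]: "successively E (rev p) \<longleftrightarrow> successively E p"
  unfolding successively_rev using E_commute by (auto cong: successively_cong)

declare successively_rev [simp del]

definition component :: "'a set \<Rightarrow> 'a \<Rightarrow> 'a set" where
  "component U q = {(a, b). E a b \<and> a \<in> U \<and> b \<in> U}\<^sup>* `` {q}"

lemma component_refl: "q \<in> component U q"
  by (simp add: component_def)

lemma component_subset: "q \<in> U \<Longrightarrow> component U q \<subseteq> U"
  unfolding component_def by (auto elim: rtranclE)

lemma component_step:
  assumes "h \<in> component U q" "E h y" "y \<in> U" "q \<in> U"
  shows "y \<in> component U q"
  using assms component_subset[OF assms(4)] unfolding component_def
  by (auto intro!: rtrancl_into_rtrancl[of q h])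

lemma path_in_component:
  assumes "q \<in> U" "U \<subseteq> V" "h \<in> component U q" "w \<in> component U q"
  obtains zs where "is_path zs" "set zs \<subseteq> component U q" "hd zs = h" "last zs = w"
proof -
  let ?r = "{(a, b). E a b \<and> a \<in> U \<and> b \<in> U}"
  have sym: "sym (?r\<^sup>*)" by (intro sym_rtrancl symI) (auto simp: E_commute)
  have "(h, w) \<in> ?r\<^sup>*"
    using assms(3,4) sym unfolding component_def by (auto dest: symD intro: rtrancl_trans)
  then have "\<exists>zs. is_path zs \<and> set zs \<subseteq> component U q \<and> hd zs = h \<and> last zs = w"
    using assms(3)
  proof (induction rule: converse_rtrancl_induct)
    case base
    then show ?case using assms component_subset[OF assms(1)]
      by (intro exI[of _ "[w]"]) (auto simp: is_path_def)
  next
    case (step y z)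
    have "z \<in> component U q" using step component_step[of y U q z] assms(1) by auto
    with step obtain zs where zs: "is_path zs" "set zs \<subseteq> component U q" "hd zs = z" "last zs = w"
      by auto
    show ?case
    proof (cases "y \<in> set zs")
      \<comment> \<open>The new vertex already occurs, so the path is cut back to begin there; this
        keeps the list distinct.\<close>
      case True
      then obtain as bs where "zs = as @ y # bs" by (meson split_list)
      then show ?thesis using zs
        by (intro exI[of _ "y # bs"]) (auto simp: is_path_def successively_append_iff)
    next
      case False
      then show ?thesis using zs step(1) assms step.prems
        by (intro exI[of _ "y # zs"]) (cases zs; auto simp: is_path_def)
    qed
  qed
  then show ?thesis using that by blast
qed

lemma path_subset_component:
  assumes "successively E zs" "set zs \<subseteq> U" "zs \<noteq> []"
  shows "set zs \<subseteq> component U (hd zs)"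
  using assms
proof (induction zs rule: rev_induct)
  case (snoc x zs)
  show ?case
  proof (cases "zs = []")
    case False
    then have "set zs \<subseteq> component U (hd zs)" "E (last zs) x"
      using snoc by (auto simp: successively_append_iff)
    moreover have "hd zs \<in> U" using snoc(3) False by auto
    ultimately show ?thesis
      using False snoc(3) component_step[of "last zs" U "hd zs" x]
        subsetD[of "set zs" "component U (hd zs)" "last zs"] by simp
  qed (simp add: component_refl)
qed simp

end

text \<open>The assumption \<open>cut\<close> expresses connectivity through neighbourhoods: if
  \<open>W\<close> and its neighbours do not exhaust \<open>V\<close>, then \<open>nbh W\<close>
  separates \<open>W\<close> from the rest.\<close>

locale connected_graph_longest_path = simple_graph +
  fixes k :: nat and P :: "'a list"
  assumes cut: "W \<subseteq> V \<Longrightarrow> W \<noteq> {} \<Longrightarrow> W \<union> nbh W \<noteq> V \<Longrightarrow> k \<le> card (nbh W)"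
    and k_pos: "1 \<le> k"
    and k_less: "k < card V"
    and path: "is_path P"
    and longest: "is_path R \<Longrightarrow> length R \<le> length P"
begin

lemma P_simps: "P \<noteq> []" "distinct P" "set P \<subseteq> V" "successively E P"
  using path by (auto simp: is_path_def)

lemma finite_nbh [simp]: "finite (nbh W)"
  using fin by (auto simp: nbh_def)

lemma degree: "x \<in> V \<Longrightarrow> k \<le> card {y. E x y}"
proof -
  assume x: "x \<in> V"
  have eq: "nbh {x} = {y. E x y}" using E_V E_irrefl by (auto simp: nbh_def)
  show ?thesis
  proof (cases "{x} \<union> nbh {x} = V")
    \<comment> \<open>Here \<open>cut\<close> does not apply, but \<open>x\<close> is adjacent to
      every other vertex, so its degree is \<open>card V - 1\<close>, which is at least
      \<open>k\<close>.\<close>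
    case True
    then have "card V \<le> Suc (card (nbh {x}))" using fin
      by (metis card_insert_le_m1 finite_nbh card_insert_if insert_is_Un le_Suc_eq nle_le)
    then show ?thesis using k_less eq by simp
  next
    case False
    then show ?thesis using cut[of "{x}"] x eq by simp
  qed
qed

section \<open>Exchange arguments on a longest path\<close>

lemma exchange_end:
  assumes "P = as @ ms" "as \<noteq> []" "is_path zs" "set zs \<inter> set P = {}" "E (last as) (hd zs)"
  shows "length zs \<le> length ms"
proof -
  have "is_path (as @ zs)"
    using assms P_simps by (auto simp: is_path_def successively_append_iff)
  from longest[OF this] show ?thesis using assms(1) by simp
qed

lemma exchange_middle:
  assumes "P = as @ ms @ bs" "as \<noteq> []" "bs \<noteq> []" "is_path zs" "set zs \<inter> set P = {}"
    "E (last as) (hd zs)" "E (last zs) (hd bs)"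
  shows "length zs \<le> length ms"
proof -
  have "is_path (as @ zs @ bs)"
    using assms P_simps by (auto simp: is_path_def successively_append_iff)
  from longest[OF this] show ?thesis using assms(1) by simp
qed

text \<open>The new path runs back through \<open>zs\<close>, then back through \<open>as\<close> to
  \<open>hd P\<close>, and takes the chord to \<open>bs\<close>; only \<open>ms\<close> is
  lost.\<close>

lemma exchange_first_rotation:
  assumes "P = as @ ms @ bs" "as \<noteq> []" "bs \<noteq> []" "is_path zs" "set zs \<inter> set P = {}"
    "E (last as) (hd zs)" "E (hd as) (hd bs)"
  shows "length zs \<le> length ms"
proof -
  have "is_path (rev zs @ rev as @ bs)"
    using assms P_simps E_commute
    by (auto simp: is_path_def successively_append_iff hd_rev last_rev)
  from longest[OF this] show ?thesis using assms(1) by simp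
qed

text \<open>After \<open>as\<close> and \<open>zs\<close> the new path enters \<open>cs\<close> at
  its last vertex, runs back to \<open>hd cs\<close>, takes the chord to \<open>last P\<close> and
  runs back through \<open>ds\<close>; only \<open>ms\<close> is lost.\<close>

lemma exchange_last_rotation:
  assumes "P = as @ ms @ cs @ ds" "as \<noteq> []" "cs \<noteq> []" "ds \<noteq> []" "is_path zs"
    "set zs \<inter> set P = {}" "E (last as) (hd zs)" "E (last zs) (last cs)" "E (last ds) (hd cs)"
  shows "length zs \<le> length ms"
proof -
  have "is_path (as @ zs @ rev cs @ rev ds)"
    using assms P_simps E_commute
    by (auto simp: is_path_def successively_append_iff hd_rev last_rev)
  from longest[OF this] show ?thesis using assms(1) by simp
qed

lemma take_P: "a < length P \<Longrightarrow> take (Suc a) P \<noteq> [] \<and> last (take (Suc a) P) = P ! a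
    \<and> hd (take (Suc a) P) = hd P"
  by (simp add: take_Suc_conv_app_nth) (cases P; cases a; simp)

lemma drop_P: "c < length P \<Longrightarrow> drop c P \<noteq> [] \<and> hd (drop c P) = P ! c \<and> last (drop c P) = last P"
  by (simp add: hd_drop_conv_nth last_drop)

lemma split_P: "a \<le> c \<Longrightarrow> P = take a P @ take (c - a) (drop a P) @ drop c P"
  by (metis append_take_drop_id drop_drop le_add_diff_inverse2)

lemma exchange_end_nth:
  assumes "a < length P" "is_path zs" "set zs \<inter> set P = {}" "E (P ! a) (hd zs)"
  shows "length zs + a < length P"
  using exchange_end[of "take (Suc a) P" "drop (Suc a) P" zs] take_P[OF assms(1)] assms by auto

text \<open>The lost segment consists of the positions strictly between \<open>a\<close> and
  \<open>c\<close>, so the bound on \<open>length zs\<close> becomes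
  \<open>length zs + a < c\<close>; likewise in the next two lemmas.\<close>

lemma exchange_middle_nth:
  assumes "a < c" "c < length P" "is_path zs" "set zs \<inter> set P = {}"
    "E (P ! a) (hd zs)" "E (last zs) (P ! c)"
  shows "length zs + a < c"
  using exchange_middle[OF split_P[of "Suc a" c], of zs] take_P[of a] drop_P[of c] assms by auto

lemma exchange_first_rotation_nth:
  assumes "a < c" "c < length P" "is_path zs" "set zs \<inter> set P = {}"
    "E (P ! a) (hd zs)" "E (hd P) (P ! c)"
  shows "length zs + a < c"
  using exchange_first_rotation[OF split_P[of "Suc a" c], of zs] take_P[of a] drop_P[of c] assms
  by auto

lemma exchange_last_rotation_nth:
  assumes "a < c" "c \<le> b" "Suc b < length P" "is_path zs" "set zs \<inter> set P = {}"
    "E (P ! a) (hd zs)" "E (last zs) (P ! b)" "E (last P) (P ! c)"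
  shows "length zs + a < c"
proof -
  \<comment> \<open>The segment occupies the positions from \<open>c\<close> to \<open>b\<close>,
    and the final one starts at \<open>Suc b\<close>.\<close>
  let ?cs = "take (Suc b - c) (drop c P)"
  have "drop c P = ?cs @ drop (Suc b) P"
    using split_P[of c "Suc b"] assms(2)
    by (metis append_take_drop_id drop_drop le_Suc_eq le_add_diff_inverse2)
  then have "P = take (Suc a) P @ take (c - Suc a) (drop (Suc a) P) @ ?cs @ drop (Suc b) P"
    using split_P[of "Suc a" c] assms(1) by simp
  moreover have "?cs \<noteq> []" "last ?cs = P ! b" "hd ?cs = P ! c"
    using assms by (auto simp: last_conv_nth hd_conv_nth)
  ultimately show ?thesis
    using exchange_last_rotation[of "take (Suc a) P" "take (c - Suc a) (drop (Suc a) P)" ?cs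
        "drop (Suc b) P" zs]
      take_P[of a] drop_P[of "Suc b"] assms by auto
qed

section \<open>Dirac's argument at the two ends\<close>

definition first_nbrs :: "nat set" where
  "first_nbrs = {i. Suc i < length P \<and> E (hd P) (P ! Suc i)}"

text \<open>Positions are shifted by one in \<open>first_nbrs\<close> but not here, so a common
  index \<open>i\<close> joins \<open>hd P\<close> to position \<open>i + 1\<close> and
  \<open>last P\<close> to position \<open>i\<close>.\<close>

definition last_nbrs :: "nat set" where
  "last_nbrs = {j. Suc j < length P \<and> E (last P) (P ! j)}"

lemma nbrs_end_in_P: "E (last P) y \<Longrightarrow> y \<in> set P"
  using exchange_end[of P "[]" "[y]"] P_simps E_V[of "last P" y] by (auto simp: is_path_def)

lemma nbrs_start_in_P: "E (hd P) y \<Longrightarrow> y \<in> set P"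
proof (rule ccontr)
  assume y: "E (hd P) y" "y \<notin> set P"
  then have "is_path (y # P)"
    using P_simps E_V[of "hd P" y] E_commute by (cases P) (auto simp: is_path_def)
  from longest[OF this] show False by simp
qed

lemma card_first_nbrs: "k \<le> card first_nbrs"
proof -
  have "{y. E (hd P) y} \<subseteq> (\<lambda>i. P ! Suc i) ` first_nbrs"
  proof
    fix y assume y: "y \<in> {y. E (hd P) y}"
    then obtain i where i: "i < length P" "P ! i = y"
      using nbrs_start_in_P by (auto simp: in_set_conv_nth)
    have "i \<noteq> 0" using i y E_irrefl P_simps(1) by (metis hd_conv_nth mem_Collect_eq)
    then show "y \<in> (\<lambda>i. P ! Suc i) ` first_nbrs"
      using i y by (intro image_eqI[of _ _ "i - 1"]) (auto simp: first_nbrs_def)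
  qed
  moreover have "finite first_nbrs" by (rule finite_subset[of _ "{..<length P}"]) (auto simp: first_nbrs_def)
  ultimately show ?thesis
    using degree[of "hd P"] P_simps surj_card_le[of first_nbrs] by (meson hd_in_set le_trans subsetD)
qed

lemma card_last_nbrs: "k \<le> card last_nbrs"
proof -
  have "{y. E (last P) y} \<subseteq> (!) P ` last_nbrs"
  proof
    fix y assume y: "y \<in> {y. E (last P) y}"
    then obtain i where i: "i < length P" "P ! i = y"
      using nbrs_end_in_P by (auto simp: in_set_conv_nth)
    have "i \<noteq> length P - 1" using i y E_irrefl P_simps(1) by (metis last_conv_nth mem_Collect_eq)
    then show "y \<in> (!) P ` last_nbrs"
      using i y by (intro image_eqI[of _ _ i]) (auto simp: last_nbrs_def)
  qed
  moreover have "finite last_nbrs" by (rule finite_subset[of _ "{..<length P}"]) (auto simp: last_nbrs_def)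
  ultimately show ?thesis
    using degree[of "last P"] P_simps surj_card_le[of last_nbrs] by (meson last_in_set le_trans subsetD)
qed

text \<open>If the cycle missed a vertex of the graph, it would by connectivity have a neighbour
  outside; opening the cycle there gives a path with one more vertex than \<open>P\<close>.\<close>

lemma no_spanning_cycle:
  assumes "is_path C" "set C = set P" "E (last C) (hd C)"
  shows "set P = V"
proof (rule ccontr)
  assume ne: "set P \<noteq> V"
  have "nbh (set P) \<noteq> {}"
  proof
    assume e: "nbh (set P) = {}"
    then show False using cut[of "set P"] ne P_simps k_pos by auto
  qed
  then obtain y w where y: "y \<in> V" "y \<notin> set P" "w \<in> set C" "E w y"
    using assms(2) by (auto simp: nbh_def)
  then obtain as bs where C: "C = as @ w # bs" by (meson split_list)
  \<comment> \<open>The cycle is rotated to start at \<open>w\<close>; the closing edge is needed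
    when \<open>as\<close> is nonempty.\<close>
  have "successively E as" "successively E (w # bs)" "as = [] \<or> E (last (w # bs)) (hd as)"
    using assms(1,3) unfolding C by (auto simp: is_path_def successively_append_iff)
  then have "successively E ((w # bs) @ as)" unfolding successively_append_iff by simp
  moreover have "distinct (w # bs @ as)" "set (w # bs @ as) \<subseteq> V"
    using assms(1) unfolding C is_path_def by auto
  moreover have "y \<notin> set (w # bs @ as)" using y(2) assms(2) C by auto
  ultimately have "is_path (y # (w # bs) @ as)"
    using y(1) E_sym[OF y(4)] by (simp add: is_path_def)
  from longest[OF this] have "length C < length P" using C by simp
  then show False using assms(1,2) P_simps by (metis distinct_card is_path_def nat_neq_iff)
qed

text \<open>A common index gives two crossing chords: the initial segment reversed, followed by the
  rest of \<open>P\<close>, closes up to a cycle on \<open>set P\<close>.\<close>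

lemma first_last_nbrs_disjoint:
  assumes "set P \<noteq> V"
  shows "first_nbrs \<inter> last_nbrs = {}"
proof (rule ccontr)
  assume "first_nbrs \<inter> last_nbrs \<noteq> {}"
  then obtain i where i: "Suc i < length P" "E (hd P) (P ! Suc i)" "E (last P) (P ! i)"
    by (auto simp: first_nbrs_def last_nbrs_def)
  let ?as = "take (Suc i) P" and ?bs = "drop (Suc i) P"
  have "distinct (?as @ ?bs)" "successively E (?as @ ?bs)" using P_simps by simp_all
  then have "is_path (rev ?as @ ?bs)"
    using i take_P[of i] drop_P[of "Suc i"] P_simps(1,3)
      set_take_disj_set_drop_if_distinct[OF P_simps(2), of "Suc i" "Suc i"] unfolding successively_append_iff is_path_def
    by (auto simp: last_rev dest: in_set_takeD in_set_dropD)
  moreover have "set (rev ?as @ ?bs) = set P"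
    by (metis append_take_drop_id set_append set_rev)
  moreover have "E (last (rev ?as @ ?bs)) (hd (rev ?as @ ?bs))"
    using i take_P[of i] drop_P[of "Suc i"] by (simp add: hd_rev)
  ultimately show False using no_spanning_cycle assms by blast
qed

lemma length_P_ge_Dirac:
  assumes "set P \<noteq> V"
  shows "2 * k + 1 \<le> length P"
proof -
  have sub: "first_nbrs \<union> last_nbrs \<subseteq> {..<length P - 1}"
    by (auto simp: first_nbrs_def last_nbrs_def)
  have "card (first_nbrs \<union> last_nbrs) = card first_nbrs + card last_nbrs"
    using first_last_nbrs_disjoint[OF assms] finite_subset[OF sub] by (intro card_Un_disjoint) auto
  then have "2 * k \<le> length P - 1"
    using card_first_nbrs card_last_nbrs card_mono[OF _ sub] by simp
  then show ?thesis using k_pos by simp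
qed

section \<open>Components off \<open>P\<close> and their attachments\<close>

definition attach :: "'a set \<Rightarrow> nat set" where
  "attach W = {a. a < length P \<and> (\<exists>w\<in>W. E (P ! a) w)}"

lemma finite_attach [simp]: "finite (attach W)"
  by (rule finite_subset[of _ "{..<length P}"]) (auto simp: attach_def)

lemma card_nbh_Int_P_le: "card (nbh W \<inter> set P) \<le> card (attach W)"
proof -
  have "nbh W \<inter> set P \<subseteq> (!) P ` attach W"
  proof
    fix y assume y: "y \<in> nbh W \<inter> set P"
    then obtain i where "i < length P" "P ! i = y" by (auto simp: in_set_conv_nth)
    moreover from y obtain w where "w \<in> W" "E y w" using E_sym by (auto simp: nbh_def)
    ultimately show "y \<in> (!) P ` attach W" by (auto simp: attach_def)
  qed
  then show ?thesis by (rule surj_card_le[OF finite_attach])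
qed

context
  fixes q
  assumes q: "q \<in> V" "q \<notin> set P"
begin

abbreviation H where "H \<equiv> component (V - set P) q"

lemma H_sub: "H \<subseteq> V - set P"
  using component_subset[of q "V - set P"] q by simp

text \<open>A neighbour outside \<open>P\<close> of a vertex of the component belongs to the
  component itself.\<close>

lemma nbh_sub:
  assumes "W \<subseteq> H"
  shows "nbh W \<subseteq> set P \<union> (H - W)"
  using component_step[of _ "V - set P" q] q assms by (auto simp: nbh_def)

lemma path_H:
  assumes "h \<in> H" "w \<in> H"
  obtains zs where "is_path zs" "set zs \<subseteq> H" "hd zs = h" "last zs = w"
  using path_in_component[of q "V - set P" h w] q assms by auto

lemma disjoint_P: "set zs \<subseteq> H \<Longrightarrow> set zs \<inter> set P = {}"
  using H_sub by auto

lemma is_path_length_ge_1: "is_path zs \<Longrightarrow> 1 \<le> length zs"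
  by (cases zs) (auto simp: is_path_def)

lemma length_ge_2_if_ends_differ: "is_path zs \<Longrightarrow> hd zs \<noteq> last zs \<Longrightarrow> 2 \<le> length zs"
  by (cases zs; cases "tl zs") (auto simp: is_path_def)

lemma path_length_2:
  assumes "2 \<le> card H" "h \<in> H"
  obtains zs where "is_path zs" "set zs \<subseteq> H" "hd zs = h" "2 \<le> length zs"
proof -
  have "H \<noteq> {h}" using assms(1) by auto
  then obtain w where "w \<in> H" "w \<noteq> h" using assms(2) by blast
  then show ?thesis
    using path_H[of h w] assms(2) length_ge_2_if_ends_differ that by metis
qed

text \<open>The end of \<open>P\<close> has all its neighbours on \<open>P\<close>. It thus
  witnesses that a subset of the component and its neighbours leave out a vertex, as
  \<open>cut\<close> demands.\<close>

lemma last_not_in_nbh: "last P \<notin> nbh W \<union> W" if "W \<subseteq> H"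
  using that nbrs_end_in_P H_sub E_commute P_simps(1) by (auto simp: nbh_def)

lemma card_nbh_ge:
  assumes "W \<subseteq> H" "W \<noteq> {}"
  shows "k \<le> card (nbh W)"
proof -
  have "last P \<in> V" using P_simps by auto
  then have "W \<union> nbh W \<noteq> V" using last_not_in_nbh[OF assms(1)] by blast
  then show ?thesis using cut[of W] assms H_sub by blast
qed

text \<open>All neighbours of \<open>W\<close> except possibly \<open>c\<close> lie on
  \<open>P\<close>; this exception costs the \<open>Suc\<close>.\<close>

lemma card_attach_ge:
  assumes "W \<subseteq> H" "W \<noteq> {}" "nbh W \<subseteq> insert c (set P)"
  shows "k \<le> Suc (card (attach W))"
proof -
  have "nbh W \<subseteq> insert c (nbh W \<inter> set P)" using assms(3) by auto
  then have "card (nbh W) \<le> card (insert c (nbh W \<inter> set P))" by (intro card_mono) auto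
  also have "\<dots> \<le> Suc (card (nbh W \<inter> set P))" by (simp add: card_insert_if)
  finally show ?thesis using card_nbh_ge[OF assms(1,2)] card_nbh_Int_P_le[of W] by simp
qed

lemma card_attach_H: "k \<le> card (attach H)"
proof -
  have "nbh H \<inter> set P = nbh H" using nbh_sub[of H] by auto
  then show ?thesis using card_nbh_ge[of H] card_nbh_Int_P_le[of H] component_refl[of q] by force
qed

lemma attach_H_nonempty: "attach H \<noteq> {}"
  using card_attach_H k_pos by auto

text \<open>
  The neighbours of the two ends of \<open>P\<close>, shifted so as to be disjoint by Dirac's argument, the
  successors of \<open>attach H\<close> and the second successors of \<open>B\<close> are pairwise disjoint sets of positions.
\<close>

lemma length_P_ge_rotation:
  assumes "2 \<le> card H" "B \<subseteq> attach H"
    and start: "\<And>a. a \<in> B \<Longrightarrow> \<exists>zs. is_path zs \<and> set zs \<subseteq> H \<and> 3 \<le> length zs \<and> E (P ! a) (hd zs)"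
    and through: "\<And>a. a \<in> B \<Longrightarrow> a < Max (attach H) \<and> (\<exists>zs. is_path zs \<and> set zs \<subseteq> H \<and> 2 \<le> length zs
        \<and> E (P ! a) (hd zs) \<and> E (last zs) (P ! Max (attach H)))"
  shows "3 * k + card B \<le> length P"
proof -
  let ?A = "attach H"
  \<comment> \<open>The last attachment is where the paths rotated at \<open>last P\<close> return
    to \<open>P\<close>.\<close>
  define m where "m = Max ?A"
  have m: "m \<in> ?A" "\<And>a. a \<in> ?A \<Longrightarrow> a \<le> m"
    using attach_H_nonempty by (auto simp: m_def)
  have att: "a < length P" "\<exists>h\<in>H. E (P ! a) h" if "a \<in> ?A" for a
    using that by (auto simp: attach_def)
  have link: "\<exists>zs. is_path zs \<and> set zs \<subseteq> H \<and> 1 \<le> length zs \<and> E (P ! a) (hd zs) \<and> E (last zs) (P ! b)"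
    if ab: "a \<in> ?A" "b \<in> ?A" for a b
  proof -
    obtain h w where "h \<in> H" "w \<in> H" "E (P ! a) h" "E (P ! b) w" using att ab by meson
    then show ?thesis using path_H[of h w] is_path_length_ge_1 E_commute by metis
  qed
  have two: "\<exists>zs. is_path zs \<and> set zs \<subseteq> H \<and> 2 \<le> length zs \<and> E (P ! a) (hd zs)"
    if "a \<in> ?A" for a
    using att[OF that] path_length_2[OF assms(1)] by metis
  \<comment> \<open>A path on two vertices of the component could replace the end of
    \<open>P\<close>, so at least two positions follow every attachment.\<close>
  have end2: "Suc (Suc a) < length P" if "a \<in> ?A" for a
    using two[OF that] exchange_end_nth[of a] att[OF that] disjoint_P by fastforce
  \<comment> \<open>A detour through the component would fit between the two positions without
    losing a vertex.\<close>
  have no_consecutive: "Suc a \<notin> ?A" if "a \<in> ?A" for a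
  proof
    assume "Suc a \<in> ?A"
    with link[of a "Suc a"] that exchange_middle_nth[of a "Suc a"] disjoint_P att(1)[of "Suc a"]
    show False by fastforce
  qed
  \<comment> \<open>The maximum is left out because a rotation starting at \<open>a\<close> needs a
    later attachment to return to.\<close>
  let ?A' = "Suc ` (?A - {m})" and ?B' = "(\<lambda>a. Suc (Suc a)) ` B"
  \<comment> \<open>The rotation would lose only position \<open>a + 1\<close> and gain two
    vertices.\<close>
  have A'_first: "?A' \<inter> first_nbrs = {}"
  proof (rule ccontr)
    assume "?A' \<inter> first_nbrs \<noteq> {}"
    then obtain a where a: "a \<in> ?A" "Suc (Suc a) < length P" "E (hd P) (P ! Suc (Suc a))"
      by (auto simp: first_nbrs_def)
    with two[of a] exchange_first_rotation_nth[of a "Suc (Suc a)"] disjoint_P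
    show False by fastforce
  qed
  \<comment> \<open>Leaving at \<open>a\<close> and returning at \<open>m\<close> would lose no
    vertex and gain at least one.\<close>
  have A'_last: "?A' \<inter> last_nbrs = {}"
  proof (rule ccontr)
    assume "?A' \<inter> last_nbrs \<noteq> {}"
    then obtain a where a: "a \<in> ?A" "a \<noteq> m" "E (last P) (P ! Suc a)"
      by (auto simp: last_nbrs_def)
    moreover have "a < m" using m(2)[of a] a by auto
    ultimately show False
      using link[of a m] m(1) exchange_last_rotation_nth[of a "Suc a" m] disjoint_P end2[of m]
      by fastforce
  qed
  \<comment> \<open>Two positions would be lost and three vertices gained, which is why
    \<open>start\<close> asks for three.\<close>
  have B'_first: "?B' \<inter> first_nbrs = {}"
  proof (rule ccontr)
    assume "?B' \<inter> first_nbrs \<noteq> {}"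
    then obtain a where a: "a \<in> B" "Suc (Suc (Suc a)) < length P" "E (hd P) (P ! Suc (Suc (Suc a)))"
      by (auto simp: first_nbrs_def)
    with start[of a] exchange_first_rotation_nth[of a "Suc (Suc (Suc a))"] disjoint_P
    show False by fastforce
  qed
  have B_m: "Suc (Suc a) < m" if "a \<in> B" for a
    using through[OF that] exchange_middle_nth[of a m] disjoint_P att(1)[OF m(1)]
    unfolding m_def by fastforce
  \<comment> \<open>Only position \<open>a + 1\<close> would be lost and two vertices gained;
    \<open>B_m\<close> puts the return at \<open>m\<close> beyond position
    \<open>a + 2\<close>.\<close>
  have B'_last: "?B' \<inter> last_nbrs = {}"
  proof (rule ccontr)
    assume "?B' \<inter> last_nbrs \<noteq> {}"
    then obtain a where a: "a \<in> B" "E (last P) (P ! Suc (Suc a))"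
      by (auto simp: last_nbrs_def)
    with through[of a] B_m[of a] exchange_last_rotation_nth[of a "Suc (Suc a)" m] disjoint_P
      end2[OF m(1)]
    show False unfolding m_def by fastforce
  qed
  \<comment> \<open>A common element would come from attachments at consecutive positions.\<close>
  have B'_A': "?B' \<inter> ?A' = {}" using no_consecutive assms(2) by auto
  have "set P \<noteq> V" using q by auto
  note FL = first_last_nbrs_disjoint[OF this]
  have sub: "first_nbrs \<union> last_nbrs \<union> ?A' \<union> ?B' \<subseteq> {..<length P - 1}"
  proof -
    have "?A' \<subseteq> {..<length P - 1}" using end2 by fastforce
    moreover have "?B' \<subseteq> {..<length P - 1}" using B_m att(1)[OF m(1)] by fastforce
    ultimately show ?thesis by (auto simp: first_nbrs_def last_nbrs_def)
  qed
  have fin': "finite first_nbrs" "finite last_nbrs" "finite ?A'" "finite ?B'"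
    using finite_subset[OF sub] by auto
  have "card (first_nbrs \<union> last_nbrs \<union> ?A' \<union> ?B') = card first_nbrs + card last_nbrs + card ?A' + card ?B'"
    using FL A'_first A'_last B'_first B'_last B'_A' fin'
    by (subst card_Un_disjoint; (auto; fail)?)+
  moreover have "card ?A' = card ?A - 1" using m(1) by (simp add: card_image)
  moreover have "card ?B' = card B" by (intro card_image inj_onI) simp
  ultimately have "card first_nbrs + card last_nbrs + (card ?A - 1) + card B \<le> length P - 1"
    using card_mono[OF _ sub] by simp
  \<comment> \<open>The first three sets contribute at least k, k and k - 1 among
    \<open>length P - 1\<close> positions, so the two losses of one cancel.\<close>
  then show ?thesis using card_first_nbrs card_last_nbrs card_attach_H k_pos by linarith
qed

section \<open>Bounds from components with at least two or three vertices\<close>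

lemma length_P_ge_3k:
  assumes "2 \<le> card H"
  shows "3 * k \<le> length P"
  using length_P_ge_rotation[OF assms, of "{}"] by simp

text \<open>
  If some \<open>c \<noteq> h\<close> starts no path on three vertices, then the component is a star with centre \<open>c\<close>,
  and a leaf other than \<open>h\<close> does; otherwise removing \<open>h\<close> from the component works.
\<close>

lemma exists_start_set:
  assumes "3 \<le> card H" "h \<in> H"
  obtains W c where "W \<subseteq> H - {h}" "W \<noteq> {}" "nbh W \<subseteq> insert c (set P)"
    "\<And>w. w \<in> W \<Longrightarrow> \<exists>zs. is_path zs \<and> set zs \<subseteq> H \<and> 3 \<le> length zs \<and> hd zs = w"
proof (cases "\<exists>c\<in>H - {h}. \<nexists>zs. is_path zs \<and> set zs \<subseteq> H \<and> 3 \<le> length zs \<and> hd zs = c")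
  case False
  moreover have "H - {h} \<noteq> {}"
  proof
    assume "H - {h} = {}"
    then have "H = {h}" using assms(2) by auto
    then show False using assms(1) by simp
  qed
  moreover have "nbh (H - {h}) \<subseteq> insert h (set P)" using nbh_sub[of "H - {h}"] by auto
  ultimately show ?thesis using that[of "H - {h}" h] by blast
next
  case True
  then obtain c where c: "c \<in> H" "c \<noteq> h"
    and none: "\<And>zs. is_path zs \<Longrightarrow> set zs \<subseteq> H \<Longrightarrow> hd zs = c \<Longrightarrow> length zs < 3"
    by (metis DiffE insertI1 not_le)
  \<comment> \<open>A path from \<open>c\<close> to \<open>w\<close> has at most two vertices, hence
    is a single edge.\<close>
  have star: "E c w" if w: "w \<in> H" "w \<noteq> c" for w
  proof -
    obtain zs where zs: "is_path zs" "set zs \<subseteq> H" "hd zs = c" "last zs = w"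
      using path_H c w by metis
    then have "length zs = 2" using none[of zs] length_ge_2_if_ends_differ[of zs] w by simp
    then show ?thesis using zs by (auto simp: is_path_def numeral_2_eq_2 length_Suc_conv)
  qed
  have "\<not> H \<subseteq> {h, c}"
  proof
    assume "H \<subseteq> {h, c}"
    then have "card H \<le> card {h, c}" by (intro card_mono) auto
    then show False using assms(1) c(2) by simp
  qed
  then obtain l where l: "l \<in> H" "l \<noteq> h" "l \<noteq> c" by auto
  have HV: "H \<subseteq> V" using H_sub by auto
  \<comment> \<open>Otherwise \<open>c\<close>, \<open>l\<close>, \<open>y\<close> would be a path
    on three vertices starting at \<open>c\<close>.\<close>
  have leaf: "y = c" if "E l y" "y \<in> H" for y
  proof (rule ccontr)
    assume "y \<noteq> c"
    then have "is_path [c, l, y]"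
      using that l star c(1) HV E_irrefl by (auto simp: is_path_def)
    then show False using none[of "[c, l, y]"] that l c by simp
  qed
  have "nbh {l} \<subseteq> insert c (set P)"
    using nbh_sub[of "{l}"] l leaf by (auto simp: nbh_def)
  moreover have "is_path [l, c, h]"
    using l c star[of l] star[of h] assms(2) HV E_commute by (auto simp: is_path_def)
  ultimately show ?thesis
    using l c assms(2) by (intro that[of "{l}" c]) (auto intro!: exI[of _ "[l, c, h]"])
qed

text \<open>Paths return to the last attachment through its neighbour \<open>h\<close>; as
  \<open>W\<close> avoids \<open>h\<close>, a path from \<open>W\<close> to \<open>h\<close> has at
  least two vertices. One attachment may be lost to \<open>c\<close> and one to the maximum, hence
  the 2.\<close>

lemma length_P_ge_4k:
  assumes "3 \<le> card H"
  shows "4 * k \<le> length P + 2"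
proof -
  let ?m = "Max (attach H)"
  have m: "?m \<in> attach H" using attach_H_nonempty by simp
  then obtain h where h: "h \<in> H" "E (P ! ?m) h" by (auto simp: attach_def)
  from exists_start_set[OF assms h(1)] obtain W c where W: "W \<subseteq> H - {h}" "W \<noteq> {}"
    "nbh W \<subseteq> insert c (set P)"
    and start: "\<And>w. w \<in> W \<Longrightarrow> \<exists>zs. is_path zs \<and> set zs \<subseteq> H \<and> 3 \<le> length zs \<and> hd zs = w"
    by metis
  let ?B = "attach W - {?m}"
  have sub: "attach W \<subseteq> attach H" using W(1) by (auto simp: attach_def)
  have "3 * k + card ?B \<le> length P"
  proof (rule length_P_ge_rotation)
    show "?B \<subseteq> attach H" using sub by auto
  next
    fix a assume a: "a \<in> ?B"
    then obtain w where w: "w \<in> W" "E (P ! a) w" by (auto simp: attach_def)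
    show "\<exists>zs. is_path zs \<and> set zs \<subseteq> H \<and> 3 \<le> length zs \<and> E (P ! a) (hd zs)"
      using start[OF w(1)] w(2) by auto
    have "a \<in> attach H" using a sub by auto
    then have "a \<le> ?m" by simp
    moreover have "w \<in> H" "w \<noteq> h" using w(1) W(1) by auto
    moreover obtain zs where "is_path zs" "set zs \<subseteq> H" "hd zs = w" "last zs = h"
      using path_H[of w h] \<open>w \<in> H\<close> h(1) by metis
    ultimately show "a < ?m \<and> (\<exists>zs. is_path zs \<and> set zs \<subseteq> H \<and> 2 \<le> length zs
        \<and> E (P ! a) (hd zs) \<and> E (last zs) (P ! ?m))"
      using a w(2) h(2) length_ge_2_if_ends_differ[of zs] E_commute by fastforce
  qed (use assms in simp)
  moreover have "k \<le> Suc (card (attach W))" using card_attach_ge[of W c] W by blast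
  moreover have "card (attach W) \<le> Suc (card ?B)"
    using diff_card_le_card_Diff[of "{?m}" "attach W"] by simp
  ultimately show ?thesis by simp
qed

end

section \<open>The intersection of two longest paths\<close>

lemma card_component_ge:
  assumes "is_path Q" "Q = as @ zs @ bs" "set zs \<inter> set P = {}" "zs \<noteq> []"
  shows "length zs \<le> card (component (V - set P) (hd zs))" "hd zs \<in> V" "hd zs \<notin> set P"
proof -
  have zs: "successively E zs" "set zs \<subseteq> V - set P" "distinct zs"
    using assms by (auto simp: is_path_def successively_append_iff)
  show hd: "hd zs \<in> V" "hd zs \<notin> set P" using zs(2) hd_in_set[OF assms(4)] by auto
  have "component (V - set P) (hd zs) \<subseteq> V"
    using component_subset[of "hd zs" "V - set P"] hd by auto
  then have "finite (component (V - set P) (hd zs))" using fin finite_subset by blast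
  then show "length zs \<le> card (component (V - set P) (hd zs))"
    using card_mono[OF _ path_subset_component[OF zs(1,2) assms(4)]] distinct_card[OF zs(3)] by simp
qed

lemma intersection_bound:
  assumes "is_path Q" "length Q = length P" "card (set P \<inter> set Q) < k"
  shows "8 * k \<le> card (set P \<inter> set Q) + card V + 4"
proof -
  let ?s = "card (set P \<inter> set Q)"
  have Q: "distinct Q" "set Q \<subseteq> V" using assms(1) by (auto simp: is_path_def)
  \<comment> \<open>If \<open>P\<close> were spanning, then so would be \<open>Q\<close>, which has
    the same length, and they would share more than k vertices.\<close>
  have "set P \<noteq> V"
  proof
    assume PV: "set P = V"
    then have "card (set Q) = card V" using assms(2) distinct_card P_simps(2) Q(1) by metis
    moreover have "set P \<inter> set Q = set Q" using PV Q by auto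
    ultimately show False using assms(3) k_less by simp
  qed
  then have p0: "2 * k + 1 \<le> length P" by (rule length_P_ge_Dirac)
  have "\<exists>as zs bs. Q = as @ zs @ bs \<and> length zs = Suc 1 \<and> set zs \<inter> set P = {}"
  proof (rule ccontr)
    assume "\<not> ?thesis"
    then have "length Q \<le> Suc 1 * ?s + 1" using Q(1) by (intro length_le_if_no_window_avoids) auto
    then show False using p0 assms by simp
  qed
  then obtain as zs bs where zs: "Q = as @ zs @ bs" "length zs = 2" "set zs \<inter> set P = {}" "zs \<noteq> []"
    by (metis Suc_1 length_0_conv nat.simps(3))
  then have p1: "3 * k \<le> length P"
    using length_P_ge_3k[of "hd zs"] card_component_ge[OF assms(1) zs(1,3,4)] by simp
  have "\<exists>as zs bs. Q = as @ zs @ bs \<and> length zs = Suc 2 \<and> set zs \<inter> set P = {}"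
  proof (rule ccontr)
    assume "\<not> ?thesis"
    \<comment> \<open>As \<open>?s\<close> is at most k - 1, the right-hand side is at most 3k -
      1.\<close>
    then have "length Q \<le> Suc 2 * ?s + 2" using Q(1) by (intro length_le_if_no_window_avoids) auto
    then show False using p1 assms by simp
  qed
  then obtain as zs bs where zs: "Q = as @ zs @ bs" "length zs = Suc 2" "set zs \<inter> set P = {}" "zs \<noteq> []"
    by (metis length_0_conv nat.simps(3))
  then have p2: "4 * k \<le> length P + 2"
    using length_P_ge_4k[of "hd zs"] card_component_ge[OF assms(1) zs(1,3,4)] by simp
  have "card (set P) + card (set Q) = card (set P \<union> set Q) + ?s"
    by (intro card_Un_Int) auto
  moreover have "card (set P \<union> set Q) \<le> card V" using P_simps(3) Q(2) fin by (intro card_mono) auto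
  moreover have "card (set P) = length P" "card (set Q) = length P"
    using assms(2) P_simps(2) Q(1) by (simp_all add: distinct_card)
  ultimately show ?thesis using p2 by simp
qed

end

section \<open>Transfer to digraphs\<close>

lemma connected_closed_set:
  assumes "Digraph_Component.connected G" "W \<subseteq> verts G" "W \<noteq> {}"
    and closed: "\<And>e. e \<in> arcs G \<Longrightarrow> tail G e \<in> W \<longleftrightarrow> head G e \<in> W"
  shows "W = verts G"
proof -
  obtain w where w: "w \<in> W" using assms(3) by blast
  have "v \<in> W" if "v \<in> verts G" for v
  proof -
    \<comment> \<open>Connectedness is reachability in the symmetric closure, where arcs may be
      followed in either direction; \<open>closed\<close> covers both.\<close>
    have "reachable (with_proj (mk_symmetric G)) w v"
      using assms(1,2) w that
      unfolding Digraph_Component.connected_def strongly_connected_def by simp blast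
    then have "(w, v) \<in> rtrancl_on (verts G) (parcs (mk_symmetric G))"
      by (simp add: reachable_def)
    then show ?thesis
    proof (induction rule: rtrancl_on_induct)
      case (step y z)
      then obtain e where "e \<in> arcs G" "(y, z) = (tail G e, head G e) \<or> (y, z) = (head G e, tail G e)"
        unfolding parcs_mk_symmetric by blast
      then show ?case using closed[of e] step by blast
    qed (rule w)
  qed
  then show ?thesis using assms(2) by auto
qed

theorem theorem1p4:
  fixes G :: "('a, 'b) pre_digraph" and k n :: nat and P Q :: "'a vwalk"
  assumes "graph G"
    and "k \<ge> 1"
    and "k_connected k G"
    and "card (verts G) = n"
    and "longest_path P G"
    and "longest_path Q G"
  shows "int (card (set P \<inter> set Q)) \<ge> min (int k) \<lceil>(8 * real k - real n - 4) / 3\<rceil>"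
proof -
  interpret graph G by (rule assms(1))
  let ?E = "\<lambda>x y. (x, y) \<in> arcs_ends G"
  interpret S: simple_graph "verts G" ?E
  proof (rule simple_graph.intro)
    show "finite (verts G)" by (rule finite_verts)
    show "x \<in> verts G \<and> y \<in> verts G" if "?E x y" for x y
      using that unfolding arcs_ends_conv by auto
    show "?E y x" if "?E x y" for x y using that sym_arcs by (rule arcs_ends_symmetric[rotated])
    show "\<not> ?E x x" for x using no_loops unfolding arcs_ends_conv by force
  qed
  have path_iff: "S.is_path p \<longleftrightarrow> vpath p G" for p
    by (auto simp: S.is_path_def vpath_def vwalk_def vwalk_arcs_subset_iff_successively)
  \<comment> \<open>\<open>vwalk_length\<close> is a truncated \<open>length - 1\<close>;
    nonemptiness (\<open>ne\<close>) later recovers the comparison of list lengths.\<close>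
  have P: "vpath P G" "\<And>R. vpath R G \<Longrightarrow> length R - 1 \<le> length P - 1"
    and Q: "vpath Q G" "\<And>R. vpath R G \<Longrightarrow> length R - 1 \<le> length Q - 1"
    using assms(5,6) by (auto simp: longest_path_def)
  have ne: "0 < length R" if "vpath R G" for R using that by (auto simp: vpath_def vwalk_def)
  interpret L: connected_graph_longest_path "verts G" ?E k P
  proof
    fix W assume W: "W \<subseteq> verts G" "W \<noteq> {}" "W \<union> S.nbh W \<noteq> verts G"
    show "k \<le> card (S.nbh W)"
    proof (rule ccontr)
      assume "\<not> k \<le> card (S.nbh W)"
      moreover have N: "S.nbh W \<subseteq> verts G" by (auto simp: S.nbh_def)
      ultimately have con: "Digraph_Component.connected (G \<restriction> (verts G - S.nbh W))"
        using assms(3) by (auto simp: k_connected_def)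
      \<comment> \<open>After deleting \<open>nbh W\<close> no arc leaves \<open>W\<close>, so
        connectedness forces \<open>W\<close> to be all that remains.\<close>
      have "W = verts (G \<restriction> (verts G - S.nbh W))"
      proof (rule connected_closed_set[OF con])
        show "W \<subseteq> verts (G \<restriction> (verts G - S.nbh W))" using W by (auto simp: S.nbh_def)
        fix e assume "e \<in> arcs (G \<restriction> (verts G - S.nbh W))"
        then have "?E (tail G e) (head G e)" "tail G e \<notin> S.nbh W" "head G e \<notin> S.nbh W"
          by (auto simp: arcs_ends_conv)
        then show "tail (G \<restriction> (verts G - S.nbh W)) e \<in> W
            \<longleftrightarrow> head (G \<restriction> (verts G - S.nbh W)) e \<in> W"
          using S.E_V S.E_sym by (auto simp: S.nbh_def)
      qed fact
      then show False using W N by auto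
    qed
  next
    show "k < card (verts G)" using assms(3) by (simp add: k_connected_def)
    show "S.is_path P" using P path_iff by simp
    show "length R \<le> length P" if "S.is_path R" for R
      using P(2)[OF that[unfolded path_iff]] ne[OF P(1)] by linarith
  qed fact
  have "length Q = length P" using P(2)[OF Q(1)] Q(2)[OF P(1)] ne[OF P(1)] ne[OF Q(1)]
    by linarith
  then have "k \<le> card (set P \<inter> set Q) \<or> 8 * k \<le> card (set P \<inter> set Q) + n + 4"
    using L.intersection_bound[of Q] Q(1) path_iff assms(4) by force
  then show ?thesis
  proof
    assume "8 * k \<le> card (set P \<inter> set Q) + n + 4"
    then have "real (8 * k) \<le> real (card (set P \<inter> set Q) + n + 4)"
      by (rule of_nat_mono)
    \<comment> \<open>The division by 3 only weakens the bound: with s the size of the intersection,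
      8k - n - 4 \<le> s \<le> 3s.\<close>
    then have "(8 * real k - real n - 4) / 3 \<le> real (card (set P \<inter> set Q))" by simp
    then have "\<lceil>(8 * real k - real n - 4) / 3\<rceil> \<le> int (card (set P \<inter> set Q))"
      by (simp add: ceiling_le_iff)
    then show ?thesis by simp
  qed simp
qed

end
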